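(* Let $H$ be an infinite-dimensional separable complex Hilbert space and let $\mathcal T=(T_1,\dots,T_n)\in B(H)^n$. Then: (i) $W_e(\mathcal T)=\bigcup_{\mathcal K\in\mathcal K(H)^n}W_\infty(\mathcal T-\mathcal K)$; (ii) there exists an $n$-tuple $\mathcal K$ of compact operators on $H$ such that $W_e(\mathcal T)=\overline{W_\infty(\mathcal T-\mathcal K)}$.
   Context: $B(H)$ is the algebra of bounded linear operators on $H$ and $\mathcal K(H)$ the ideal of compact operators on $H$; the operators $T_j$ are not assumed to commute. For $\mathcal K=(K_1,\dots,K_n)\in B(H)^n$, $\mathcal T-\mathcal K=(T_1-K_1,\dots,T_n-K_n)$. Joint essential numerical range: $W_e(\mathcal T)$ is the set of all $(\lambda_1,\dots,\lambda_n)\in\mathbb C^n$ for which there exists an orthonormal sequence $(x_k)_{k\ge1}\subset H$ with $\lim_{k\to\infty}\langle T_jx_k,x_k\rangle=\lambda_j$ for $j=1,\dots,n$. Infinite numerical range: $W_\infty(\mathcal T)$ is the set of all $(\lambda_1,\dots,\lambda_n)\in\mathbb C^n$ for which there exists an infinite-dimensional closed subspace $L\subset H$, with orthogonal projection $P_L$, such that $P_LT_jP_L=\lambda_jP_L$ for $j=1,\dots,n$. *)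

theory Defs
  imports "HOL-Analysis.Analysis"
begin

section \<open>Complex Hilbert spaces\<close>

text \<open>The inner product is linear in the first and conjugate-linear in the second argument.
  Separability and infinite dimension are not part of the class.\<close>

class complex_inner = real_normed_vector +
  fixes scaleC :: "complex \<Rightarrow> 'a \<Rightarrow> 'a" (infixr \<open>*\<^sub>C\<close> 75)
    and cinner :: "'a \<Rightarrow> 'a \<Rightarrow> complex"
  assumes scaleC_add_right: "a *\<^sub>C (x + y) = a *\<^sub>C x + a *\<^sub>C y"
    and scaleC_add_left: "(a + b) *\<^sub>C x = a *\<^sub>C x + b *\<^sub>C x"
    and scaleC_scaleC: "a *\<^sub>C b *\<^sub>C x = (a * b) *\<^sub>C x"
    and scaleC_one: "1 *\<^sub>C x = x"
    and scaleR_scaleC: "r *\<^sub>R x = complex_of_real r *\<^sub>C x"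
    and cinner_add_left: "cinner (x + y) z = cinner x z + cinner y z"
    and cinner_scaleC_left: "cinner (a *\<^sub>C x) y = a * cinner x y"
    and cinner_commute: "cinner x y = cnj (cinner y x)"
    and cinner_self: "cinner x x = complex_of_real ((norm x)\<^sup>2)"

class chilbert_space = complex_inner + complete_space

global_interpretation complex_vector:
  vector_space "scaleC :: complex \<Rightarrow> 'a \<Rightarrow> 'a::complex_inner"
  defines csubspace_raw_def: csubspace = complex_vector.subspace
    and cspan_raw_def: cspan = complex_vector.span
  by unfold_locales
    (simp_all add: scaleC_add_right scaleC_add_left scaleC_scaleC scaleC_one)

definition cfinite_dim :: "'a::complex_inner set \<Rightarrow> bool" where
  "cfinite_dim S \<longleftrightarrow> (\<exists>B. finite B \<and> cspan B = S)"


section \<open>Bounded and compact operators\<close>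

definition bounded_clinear :: "('a::complex_inner \<Rightarrow> 'a) \<Rightarrow> bool" where
  "bounded_clinear T \<longleftrightarrow> bounded_linear T \<and> (\<forall>c x. T (c *\<^sub>C x) = c *\<^sub>C T x)"

definition compact_operator :: "('a::complex_inner \<Rightarrow> 'a) \<Rightarrow> bool" where
  "compact_operator K \<longleftrightarrow> bounded_clinear K \<and> compact (closure (K ` cball 0 1))"

text \<open>For a closed subspace \<open>L\<close> of a Hilbert space, the point described below exists and is unique
  by the projection theorem; for other sets the value is irrelevant.\<close>

definition orth_proj :: "'a::complex_inner set \<Rightarrow> 'a \<Rightarrow> 'a" where
  "orth_proj L x = (THE y. y \<in> L \<and> (\<forall>z\<in>L. cinner (x - y) z = 0))"


section \<open>Joint numerical ranges\<close>

definition orthonormal_seq :: "(nat \<Rightarrow> 'a::complex_inner) \<Rightarrow> bool" where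
  "orthonormal_seq x \<longleftrightarrow> (\<forall>i j. cinner (x i) (x j) = (if i = j then 1 else 0))"

definition W_ess :: "('n::finite \<Rightarrow> 'a::chilbert_space \<Rightarrow> 'a) \<Rightarrow> (complex ^ 'n) set" where
  "W_ess T = {l. \<exists>x. orthonormal_seq x \<and>
     (\<forall>j. (\<lambda>k. cinner (T j (x k)) (x k)) \<longlonglongrightarrow> l $ j)}"

definition W_infty :: "('n::finite \<Rightarrow> 'a::chilbert_space \<Rightarrow> 'a) \<Rightarrow> (complex ^ 'n) set" where
  "W_infty T = {l. \<exists>L. csubspace L \<and> closed L \<and> \<not> cfinite_dim L \<and>
     (\<forall>j x. orth_proj L (T j (orth_proj L x)) = l $ j *\<^sub>C orth_proj L x)}"

end

theory Submission
  imports Defs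
begin

text \<open>An orthonormal sequence converges weakly to zero, and a compact operator turns this into
  \<open>\<langle>K x\<^sub>k, x\<^sub>k\<rangle> \<longlonglongrightarrow> 0\<close>. If the compression of every \<open>T\<^sub>j - K\<^sub>j\<close> to an infinite-dimensional
  subspace is a scalar, then along an orthonormal sequence in that subspace the forms of the \<open>T\<^sub>j\<close>
  converge to these scalars. Hence \<open>W_infty (T - K) \<subseteq> W_ess T\<close>
  (\<open>W_infty_compact_perturbation_subset\<close>).

  Conversely, let \<open>\<mu>\<^sub>0, \<mu>\<^sub>1, \<dots>\<close> be points of \<open>W_ess T\<close>. Choose unit vectors \<open>x\<^sub>0, x\<^sub>1, \<dots>\<close> one
  after the other. At stage \<open>s\<close>, far along a sequence that witnesses \<open>\<mu>\<^sub>s \<in> W_ess T\<close>, the vectors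
  are almost orthogonal to the finitely many earlier \<open>x\<^sub>r\<close>, and \<open>\<langle>T\<^sub>j x\<^sub>s, x\<^sub>r\<rangle>\<close> and
  \<open>\<langle>T\<^sub>j x\<^sub>r, x\<^sub>s\<rangle>\<close> are as small as desired; a small correction makes them exactly orthogonal. So the
  matrix of \<open>T\<^sub>j\<close> along the \<open>x\<^sub>s\<close> differs from the diagonal matrix with entries \<open>\<mu>\<^sub>s\<close> by a matrix whose
  \<open>(r, s)\<close> entry is at most \<open>2\<close> to the power \<open>-(r + s)\<close> (\<open>nearly_diagonalizing_sequence\<close>). Such
  an error matrix belongs to a nuclear, hence compact, operator \<open>K\<^sub>j\<close>
  (\<open>compact_operator_with_matrix\<close>). After subtracting it, every point that occurs infinitely often
  among the \<open>\<mu>\<^sub>s\<close> lies in the infinite numerical range, the subspace being the closed span of the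
  corresponding \<open>x\<^sub>s\<close> (\<open>compact_perturbation_attains\<close>).

  A constant sequence \<open>\<mu>\<close> gives (i). For (ii), let \<open>\<mu>\<close> visit every point of a countable dense
  subset of \<open>W_ess T\<close> infinitely often: a single \<open>K\<close> then puts the whole dense subset into
  \<open>W_infty (T - K)\<close>. The other inclusion holds because \<open>W_ess T\<close> is closed, which is again a
  consequence of the choice of the \<open>x\<^sub>s\<close> (\<open>closed_W_ess\<close>).\<close>

section \<open>Geometry of the inner product\<close>

instance chilbert_space \<subseteq> banach ..

lemma cinner_add_right: "cinner x (y + z) = cinner x y + cinner x (z::'a::complex_inner)"
  by (metis cinner_add_left cinner_commute complex_cnj_add)

lemma cinner_scaleC_right: "cinner x (a *\<^sub>C y) = cnj a * cinner x (y::'a::complex_inner)"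
  by (metis cinner_scaleC_left cinner_commute complex_cnj_mult)

lemma cinner_zero_left: "cinner 0 (y::'a::complex_inner) = 0"
  using cinner_add_left[of 0 0 y] by simp

lemma cinner_minus_left: "cinner (- x) y = - cinner x (y::'a::complex_inner)"
  using cinner_add_left[of x "- x" y] by (simp add: cinner_zero_left minus_unique)

lemma cinner_diff_left: "cinner (x - z) y = cinner x y - cinner z (y::'a::complex_inner)"
  using cinner_add_left[of x "- z" y] by (simp add: cinner_minus_left)

lemma cinner_commute_zero: "cinner x y = 0 \<longleftrightarrow> cinner y (x::'a::complex_inner) = 0"
  by (metis cinner_commute complex_cnj_zero)

lemma norm_scaleC: "norm (a *\<^sub>C (x::'a::complex_inner)) = cmod a * norm x"
proof -
  have "complex_of_real ((norm (a *\<^sub>C x))\<^sup>2) = (a * cnj a) * complex_of_real ((norm x)\<^sup>2)"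
    unfolding cinner_self[symmetric] cinner_scaleC_left cinner_scaleC_right by simp
  also have "\<dots> = complex_of_real ((cmod a * norm x)\<^sup>2)"
    by (simp only: complex_norm_square[symmetric] power_mult_distrib of_real_mult)
  finally have "(norm (a *\<^sub>C x))\<^sup>2 = (cmod a * norm x)\<^sup>2"
    using of_real_eq_iff by blast
  thus ?thesis by simp
qed

lemma Pythagoras:
  fixes x y :: "'a::complex_inner"
  assumes "cinner x y = 0"
  shows "(norm (x + y))\<^sup>2 = (norm x)\<^sup>2 + (norm y)\<^sup>2"
proof -
  have "complex_of_real ((norm (x + y))\<^sup>2) = complex_of_real ((norm x)\<^sup>2 + (norm y)\<^sup>2)"
    unfolding cinner_self[symmetric] of_real_add cinner_add_left cinner_add_right
    using assms cinner_commute_zero[of x y] by simp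
  thus ?thesis using of_real_eq_iff by blast
qed

text \<open>Subtracting the component along \<open>y\<close>; this one decomposition yields both the
  Cauchy--Schwarz inequality and the orthogonality of a nearest-point residual.\<close>

lemma orthogonal_component:
  fixes x y :: "'a::complex_inner"
  assumes "y \<noteq> 0"
  defines "t \<equiv> cinner x y / complex_of_real ((norm y)\<^sup>2)"
  shows "(norm x)\<^sup>2 = (norm (x - t *\<^sub>C y))\<^sup>2 + (cmod (cinner x y) / norm y)\<^sup>2"
proof -
  have "cinner (x - t *\<^sub>C y) y = 0"
    using assms by (simp add: cinner_diff_left cinner_scaleC_left cinner_self)
  hence "cinner (x - t *\<^sub>C y) (t *\<^sub>C y) = 0" by (simp add: cinner_scaleC_right)
  from Pythagoras[OF this] have "(norm x)\<^sup>2 = (norm (x - t *\<^sub>C y))\<^sup>2 + (norm (t *\<^sub>C y))\<^sup>2" by simp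
  moreover have "norm (t *\<^sub>C y) = cmod (cinner x y) / norm y"
    using assms(1) by (simp add: t_def norm_scaleC norm_divide norm_mult power2_eq_square)
  ultimately show ?thesis by simp
qed

lemma Cauchy_Schwarz: "cmod (cinner x y) \<le> norm x * norm (y::'a::complex_inner)"
proof (cases "y = 0")
  case True
  then show ?thesis using cinner_commute_zero[of x 0] by (simp add: cinner_zero_left)
next
  case False
  have "(cmod (cinner x y) / norm y)\<^sup>2 \<le> (norm x)\<^sup>2"
    using orthogonal_component[OF False, of x] by simp
  hence "cmod (cinner x y) / norm y \<le> norm x" by (rule power2_le_imp_le) simp
  thus ?thesis using False by (simp add: field_simps)
qed

lemma bounded_bilinear_cinner: "bounded_bilinear (cinner :: 'a::complex_inner \<Rightarrow> _)"
proof
  show "\<exists>K. \<forall>a b::'a. norm (cinner a b) \<le> norm a * norm b * K"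
    by (rule exI[of _ 1]) (simp add: Cauchy_Schwarz)
qed (simp_all add: cinner_add_left cinner_add_right scaleR_scaleC cinner_scaleC_left
      cinner_scaleC_right scaleR_conv_of_real)

interpretation cinner: bounded_bilinear "cinner :: 'a::complex_inner \<Rightarrow> 'a \<Rightarrow> complex"
  by (rule bounded_bilinear_cinner)

lemma bounded_linear_scaleC_left: "bounded_linear (\<lambda>c. c *\<^sub>C (w::'a::complex_inner))"
  by (rule bounded_linear_intro[where K = "norm w"])
    (simp_all add: scaleC_add_left scaleR_scaleC scaleC_scaleC norm_scaleC scaleR_conv_of_real)

lemma bounded_linear_scaleC_right: "bounded_linear (\<lambda>w::'a::complex_inner. c *\<^sub>C w)"
  by (rule bounded_linear_intro[where K = "cmod c"])
    (simp_all add: scaleC_add_right scaleR_scaleC scaleC_scaleC norm_scaleC mult.commute)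

lemma parallelogram:
  fixes a b :: "'a::complex_inner"
  shows "(norm (a + b))\<^sup>2 + (norm (a - b))\<^sup>2 = 2 * (norm a)\<^sup>2 + 2 * (norm b)\<^sup>2"
proof -
  have "complex_of_real ((norm (a + b))\<^sup>2 + (norm (a - b))\<^sup>2)
      = complex_of_real (2 * (norm a)\<^sup>2 + 2 * (norm b)\<^sup>2)"
    unfolding of_real_add of_real_mult cinner_self[symmetric]
    by (simp add: cinner.add_left cinner.add_right cinner.diff_left cinner.diff_right)
  thus ?thesis using of_real_eq_iff by blast
qed


section \<open>Orthogonal projections\<close>

text \<open>By the parallelogram law a minimizing sequence for the distance from \<open>x\<close> to \<open>L\<close>
  is Cauchy, because midpoints stay in \<open>L\<close>. The residual at the limit is orthogonal to \<open>L\<close>, as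
  otherwise subtracting its component along an element of \<open>L\<close> would come closer.\<close>

lemma projection_exists:
  fixes L :: "'a::chilbert_space set"
  assumes sub: "csubspace L" and cl: "closed L"
  shows "\<exists>y\<in>L. \<forall>z\<in>L. cinner (x - y) z = 0"
proof -
  have ne: "L \<noteq> {}" using complex_vector.subspace_0[OF sub] by blast
  define d where "d = infdist x L"
  have d0: "0 \<le> d" by (simp add: d_def infdist_nonneg)
  have dle: "d \<le> norm (x - a)" if "a \<in> L" for a
    using infdist_le[OF that, of x] by (simp add: d_def dist_norm)
  have "\<exists>y\<in>L. norm (x - y) < d + 1 / real (Suc n)" for n
  proof (rule ccontr)
    assume "\<not> ?thesis"
    hence "\<And>y. y \<in> L \<Longrightarrow> d + 1 / real (Suc n) \<le> dist x y" by (force simp: dist_norm)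
    hence "d + 1 / real (Suc n) \<le> infdist x L"
      unfolding infdist_def using ne by (auto intro: cINF_greatest)
    thus False unfolding d_def by simp
  qed
  then obtain y where yL: "\<And>n. y n \<in> L" and yd: "\<And>n. norm (x - y n) < d + 1 / real (Suc n)"
    by metis
  have key: "(norm (y m - y n))\<^sup>2 \<le> 4 * (d + 1 / real (Suc N))\<^sup>2 - 4 * d\<^sup>2"
    if "N \<le> m" "N \<le> n" for m n N
  proof -
    define h where "h = (1/2) *\<^sub>R (y m + y n)"
    have hL: "h \<in> L"
      unfolding h_def scaleR_scaleC using yL sub
      by (intro complex_vector.subspace_scale complex_vector.subspace_add)
    have b: "(norm (x - y k))\<^sup>2 \<le> (d + 1 / real (Suc N))\<^sup>2" if "N \<le> k" for k
    proof (rule power_mono)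
      have "1 / real (Suc k) \<le> 1 / real (Suc N)" using that by (simp add: frac_le)
      thus "norm (x - y k) \<le> d + 1 / real (Suc N)" using yd[of k] by simp
    qed simp
    have "(norm ((x - y m) + (x - y n)))\<^sup>2 = 4 * (norm (x - h))\<^sup>2"
    proof -
      have "(x - y m) + (x - y n) = 2 *\<^sub>R (x - h)"
        unfolding h_def by (simp add: scaleR_diff_right scaleR_2)
      thus ?thesis by (simp add: power_mult_distrib)
    qed
    moreover have "d\<^sup>2 \<le> (norm (x - h))\<^sup>2" using dle[OF hL] d0 by (rule power_mono)
    moreover have "norm ((x - y m) - (x - y n)) = norm (y m - y n)"
      by (simp add: norm_minus_commute)
    ultimately show ?thesis
      using parallelogram[of "x - y m" "x - y n"] b[OF that(1)] b[OF that(2)] by simp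
  qed
  have lim0: "(\<lambda>N. 1 / real (Suc N)) \<longlonglongrightarrow> 0"
    using LIMSEQ_inverse_real_of_nat by (simp add: inverse_eq_divide)
  have "(\<lambda>N. 4 * (d + 1 / real (Suc N))\<^sup>2 - 4 * d\<^sup>2) \<longlonglongrightarrow> 4 * (d + 0)\<^sup>2 - 4 * d\<^sup>2"
    by (intro tendsto_intros lim0)
  hence lim: "(\<lambda>N. 4 * (d + 1 / real (Suc N))\<^sup>2 - 4 * d\<^sup>2) \<longlonglongrightarrow> 0" by simp
  have "Cauchy y"
  proof (rule CauchyI)
    fix e :: real assume e: "0 < e"
    have "eventually (\<lambda>N. 4 * (d + 1 / real (Suc N))\<^sup>2 - 4 * d\<^sup>2 < e\<^sup>2) sequentially"
      using order_tendstoD(2)[OF lim] e by simp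
    then obtain N where N: "4 * (d + 1 / real (Suc N))\<^sup>2 - 4 * d\<^sup>2 < e\<^sup>2"
      using eventually_happens' sequentially_bot by blast
    have "norm (y m - y n) < e" if "N \<le> m" "N \<le> n" for m n
      by (rule power_less_imp_less_base[where n = 2]) (use key[OF that] N e in auto)
    thus "\<exists>M. \<forall>m\<ge>M. \<forall>n\<ge>M. norm (y m - y n) < e" by blast
  qed
  then obtain p where p: "y \<longlonglongrightarrow> p" using Cauchy_convergent_iff convergent_def by blast
  have pL: "p \<in> L" using cl yL p by (meson closed_sequentially)
  have "norm (x - p) \<le> d"
  proof (rule LIMSEQ_le)
    show "(\<lambda>n. norm (x - y n)) \<longlonglongrightarrow> norm (x - p)" by (intro tendsto_intros p)
    show "(\<lambda>n. d + 1 / real (Suc n)) \<longlonglongrightarrow> d"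
      using tendsto_add[OF tendsto_const lim0, of d] by simp
    show "\<exists>N. \<forall>n\<ge>N. norm (x - y n) \<le> d + 1 / real (Suc n)" using yd less_imp_le by blast
  qed
  have "cinner (x - p) z = 0" if zL: "z \<in> L" for z
  proof (cases "z = 0")
    case True
    then show ?thesis by (simp add: cinner.zero_right)
  next
    case False
    define t where "t = cinner (x - p) z / complex_of_real ((norm z)\<^sup>2)"
    have "p + t *\<^sub>C z \<in> L"
      using sub pL zL by (intro complex_vector.subspace_scale complex_vector.subspace_add)
    from dle[OF this] have "norm (x - p) \<le> norm (x - p - t *\<^sub>C z)"
      using \<open>norm (x - p) \<le> d\<close> by (simp add: diff_diff_eq)
    hence "(norm (x - p))\<^sup>2 \<le> (norm (x - p - t *\<^sub>C z))\<^sup>2" by (intro power_mono) auto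
    with orthogonal_component[OF False, of "x - p"]
    have "(cmod (cinner (x - p) z) / norm z)\<^sup>2 \<le> 0" by (simp add: t_def)
    thus ?thesis using False by simp
  qed
  with pL show ?thesis by blast
qed

lemma orth_proj_eqI:
  fixes L :: "'a::complex_inner set"
  assumes "csubspace L" "y \<in> L" "\<And>z. z \<in> L \<Longrightarrow> cinner (x - y) z = 0"
  shows "orth_proj L x = y"
  unfolding orth_proj_def
proof (rule the_equality)
  fix y' assume y': "y' \<in> L \<and> (\<forall>z\<in>L. cinner (x - y') z = 0)"
  have "y' - y \<in> L" using assms y' by (simp add: complex_vector.subspace_diff)
  hence "cinner (x - y) (y' - y) = 0" "cinner (x - y') (y' - y) = 0" using assms y' by auto
  hence "cinner ((x - y) - (x - y')) (y' - y) = 0" by (simp only: cinner.diff_left[of "x - y"]) simp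
  hence "cinner (y' - y) (y' - y) = 0" by simp
  thus "y' = y" by (simp add: cinner_self)
qed (use assms in auto)

lemma
  fixes L :: "'a::chilbert_space set"
  assumes "csubspace L" "closed L"
  shows orth_proj_in: "orth_proj L x \<in> L"
    and orth_proj_orthogonal: "z \<in> L \<Longrightarrow> cinner (x - orth_proj L x) z = 0"
proof -
  obtain y where y: "y \<in> L" "\<And>z. z \<in> L \<Longrightarrow> cinner (x - y) z = 0"
    using projection_exists[OF assms] by blast
  have "orth_proj L x = y" using orth_proj_eqI[OF assms(1) y] .
  thus "orth_proj L x \<in> L" "z \<in> L \<Longrightarrow> cinner (x - orth_proj L x) z = 0" using y by auto
qed

text \<open>This trades projections for inner products: a vector has projection zero exactly when it is
  orthogonal to \<open>L\<close>. The condition on the right is continuous and sesquilinear in \<open>y\<close> and \<open>z\<close>, so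
  it can be checked on generators of \<open>L\<close>.\<close>

lemma compression_scalar_iff:
  fixes L :: "'a::chilbert_space set"
  assumes sub: "csubspace L" and cl: "closed L"
  shows "(\<forall>x. orth_proj L (S (orth_proj L x)) = c *\<^sub>C orth_proj L x) \<longleftrightarrow>
    (\<forall>y\<in>L. \<forall>z\<in>L. cinner (S y - c *\<^sub>C y) z = 0)"
proof (intro iffI ballI allI)
  fix y z assume *: "\<forall>x. orth_proj L (S (orth_proj L x)) = c *\<^sub>C orth_proj L x" and yz: "y \<in> L" "z \<in> L"
  have "orth_proj L y = y" by (rule orth_proj_eqI[OF sub yz(1)]) (simp add: cinner_zero_left)
  with * have "orth_proj L (S y) = c *\<^sub>C y" by metis
  with orth_proj_orthogonal[OF sub cl yz(2), of "S y"] show "cinner (S y - c *\<^sub>C y) z = 0" by simp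
next
  fix x assume *: "\<forall>y\<in>L. \<forall>z\<in>L. cinner (S y - c *\<^sub>C y) z = 0"
  have "orth_proj L x \<in> L" using sub cl by (rule orth_proj_in)
  thus "orth_proj L (S (orth_proj L x)) = c *\<^sub>C orth_proj L x"
    using * sub by (intro orth_proj_eqI) (auto intro: complex_vector.subspace_scale)
qed


section \<open>Orthonormal sequences\<close>

definition orthonormal_below :: "nat \<Rightarrow> (nat \<Rightarrow> 'a::complex_inner) \<Rightarrow> bool" where
  "orthonormal_below n x \<longleftrightarrow> (\<forall>i<n. \<forall>j<n. cinner (x i) (x j) = (if i = j then 1 else 0))"

lemma orthonormal_seq_norm: "orthonormal_seq x \<Longrightarrow> norm (x k) = 1"
proof -
  assume "orthonormal_seq x"
  hence "complex_of_real ((norm (x k))\<^sup>2) = complex_of_real 1"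
    unfolding cinner_self[symmetric] by (simp add: orthonormal_seq_def)
  hence "(norm (x k))\<^sup>2 = 1\<^sup>2" by (simp only: of_real_eq_iff one_power2)
  thus ?thesis by (rule power2_eq_imp_eq) simp_all
qed

text \<open>Dependent choice of orthonormal sequences inside \<open>A\<close>, built one vector at a time, where the requirement \<open>Q\<close> on the next
  vector may refer to the vectors chosen before it; \<open>cong\<close> says that it refers to no others.\<close>

lemma orthonormal_choice:
  fixes Q :: "(nat \<Rightarrow> 'a::complex_inner) \<Rightarrow> nat \<Rightarrow> 'a \<Rightarrow> bool" and A :: "'a set"
  assumes cong: "\<And>f g n v. (\<And>i. i < n \<Longrightarrow> f i = g i) \<Longrightarrow> Q f n v = Q g n v"
    and step: "\<And>f n. orthonormal_below n f \<Longrightarrow> (\<And>i. i < n \<Longrightarrow> f i \<in> A) \<Longrightarrow>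
      \<exists>v\<in>A. norm v = 1 \<and> (\<forall>i<n. cinner v (f i) = 0) \<and> Q f n v"
  obtains x where "orthonormal_seq x" "\<And>n. x n \<in> A" "\<And>n. Q x n (x n)"
proof -
  define P where "P f n v \<longleftrightarrow> v \<in> A \<and> norm v = 1 \<and> (\<forall>i<n. cinner v (f i) = 0) \<and> Q f n v" for f n v
  have orth: "cinner (f i) (f j) = (if i = j then 1 else 0)"
    if "P f i (f i)" "P f j (f j)" for f i j
  proof (cases i j rule: linorder_cases)
    case less
    then show ?thesis using that cinner_commute_zero[of "f i" "f j"] by (simp add: P_def)
  next
    case equal
    then show ?thesis using that by (simp add: P_def cinner_self)
  next
    case greater
    then show ?thesis using that by (simp add: P_def)
  qed
  have "\<exists>f. \<forall>n. P f n (f n)"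
  proof (rule dependent_wf_choice[OF wf_less_than])
    fix f g :: "nat \<Rightarrow> 'a" and n v
    assume "\<And>z. (z, n) \<in> less_than \<Longrightarrow> f z = g z"
    hence *: "\<And>i. i < n \<Longrightarrow> f i = g i" by simp
    have "Q f n v = Q g n v" by (rule cong) (rule *)
    with * show "P f n v = P g n v" by (simp add: P_def)
  next
    fix n and f :: "nat \<Rightarrow> 'a"
    assume *: "\<And>y. (y, n) \<in> less_than \<Longrightarrow> P f y (f y)"
    hence "orthonormal_below n f" using orth by (simp add: orthonormal_below_def)
    moreover have "\<And>i. i < n \<Longrightarrow> f i \<in> A" using * by (simp add: P_def)
    ultimately show "\<exists>r. P f n r" using step[of n f] by (auto simp: P_def)
  qed
  then obtain x where x: "\<And>n. P x n (x n)" by blast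
  show thesis
  proof (rule that[of x])
    show "orthonormal_seq x" unfolding orthonormal_seq_def using orth[OF x x] by blast
    show "x n \<in> A" "Q x n (x n)" for n using x[of n] by (simp_all add: P_def)
  qed
qed

definition partial_proj :: "nat \<Rightarrow> (nat \<Rightarrow> 'a::complex_inner) \<Rightarrow> 'a \<Rightarrow> 'a" where
  "partial_proj n f v = (\<Sum>r<n. cinner v (f r) *\<^sub>C f r)"

lemma partial_proj_orthogonal:
  assumes "orthonormal_below n f" "s < n"
  shows "cinner (v - partial_proj n f v) (f s) = 0"
proof -
  have "cinner (partial_proj n f v) (f s) = (\<Sum>r<n. cinner v (f r) * cinner (f r) (f s))"
    by (simp add: partial_proj_def cinner.sum_left cinner_scaleC_left)
  also have "\<dots> = (\<Sum>r<n. if r = s then cinner v (f s) else 0)"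
    by (rule sum.cong) (use assms in \<open>auto simp: orthonormal_below_def\<close>)
  finally show ?thesis using assms(2) by (simp add: cinner.diff_left)
qed

lemma norm_sum_orthonormal:
  assumes "orthonormal_seq x"
  shows "(norm (\<Sum>k<n. c k *\<^sub>C x k))\<^sup>2 = (\<Sum>k<n. (cmod (c k))\<^sup>2)"
proof (induction n)
  case (Suc n)
  have "cinner (\<Sum>k<n. c k *\<^sub>C x k) (c n *\<^sub>C x n) = 0"
    using assms by (simp add: cinner.sum_left cinner_scaleC_left cinner_scaleC_right orthonormal_seq_def)
  from Pythagoras[OF this] show ?case
    using Suc orthonormal_seq_norm[OF assms] by (simp add: norm_scaleC)
qed simp

lemma bounded_clinear_sum:
  "bounded_clinear T \<Longrightarrow> T (\<Sum>k<n. c k *\<^sub>C x k) = (\<Sum>k<n. c k *\<^sub>C T (x k))"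
  unfolding bounded_clinear_def by (simp add: linear_sum bounded_linear.linear)

text \<open>Orthonormal sequences converge weakly to zero, also after applying \<open>T\<close>. The Bessel
  inequality for the functional \<open>v \<mapsto> \<langle>T v, w\<rangle>\<close> comes from testing it on
  \<open>\<Sum>k<n. cnj \<langle>T x\<^sub>k, w\<rangle> x\<^sub>k\<close>, so that no adjoint of \<open>T\<close> is involved.\<close>

lemma orthonormal_weakly_null:
  fixes T :: "'a::complex_inner \<Rightarrow> 'a"
  assumes x: "orthonormal_seq x" and T: "bounded_clinear T"
  shows "(\<lambda>k. cinner (T (x k)) w) \<longlonglongrightarrow> 0"
proof -
  obtain B where B: "\<And>v. norm (T v) \<le> norm v * B" and B0: "0 < B"
    using T bounded_linear.pos_bounded unfolding bounded_clinear_def by blast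
  define a where "a k = cinner (T (x k)) w" for k
  have bound: "(\<Sum>k<n. (cmod (a k))\<^sup>2) \<le> (B * norm w)\<^sup>2" for n
  proof -
    define S where "S = (\<Sum>k<n. (cmod (a k))\<^sup>2)"
    define y where "y = (\<Sum>k<n. cnj (a k) *\<^sub>C x k)"
    have S0: "0 \<le> S" by (simp add: S_def sum_nonneg)
    have ny: "(norm y)\<^sup>2 = S" using norm_sum_orthonormal[OF x] by (simp add: y_def S_def)
    have "cinner (T y) w = (\<Sum>k<n. cnj (a k) * a k)"
      by (simp add: y_def bounded_clinear_sum[OF T] cinner.sum_left cinner_scaleC_left a_def)
    also have "\<dots> = complex_of_real S"
      unfolding S_def of_real_sum by (rule sum.cong) (simp_all only: complex_norm_square mult.commute)
    finally have "S = cmod (cinner (T y) w)" using S0 by simp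
    also have "\<dots> \<le> norm (T y) * norm w" by (rule Cauchy_Schwarz)
    also have "\<dots> \<le> norm y * B * norm w" by (intro mult_right_mono B) simp
    finally have "norm y * norm y \<le> norm y * (B * norm w)"
      using ny by (simp add: power2_eq_square mult.assoc)
    hence "norm y \<le> B * norm w" using B0
      by (cases "norm y = 0") (auto simp: mult_le_cancel_left)
    hence "(norm y)\<^sup>2 \<le> (B * norm w)\<^sup>2" by (rule power_mono) simp
    thus ?thesis using ny S_def by simp
  qed
  have "summable (\<lambda>k. (cmod (a k))\<^sup>2)"
    by (rule summableI_nonneg_bounded[where x = "(B * norm w)\<^sup>2"]) (use bound in auto)
  hence "(\<lambda>k. (cmod (a k))\<^sup>2) \<longlonglongrightarrow> 0" by (rule summable_LIMSEQ_zero)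
  hence "(\<lambda>k. sqrt ((cmod (a k))\<^sup>2)) \<longlonglongrightarrow> sqrt 0" by (rule tendsto_real_sqrt)
  thus ?thesis by (simp add: a_def tendsto_norm_zero_iff)
qed

lemma bounded_clinear_ident: "bounded_clinear (\<lambda>v. v)"
  by (simp add: bounded_clinear_def bounded_linear_ident)

lemma orthonormal_weakly_null':
  assumes "orthonormal_seq x"
  shows "(\<lambda>k. cinner (x k) w) \<longlonglongrightarrow> 0" "(\<lambda>k. cinner w (x k)) \<longlonglongrightarrow> 0"
proof -
  show *: "(\<lambda>k. cinner (x k) w) \<longlonglongrightarrow> 0"
    using orthonormal_weakly_null[OF assms bounded_clinear_ident] .
  have "(\<lambda>k. cnj (cinner (x k) w)) \<longlonglongrightarrow> cnj 0" by (intro tendsto_cnj *)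
  thus "(\<lambda>k. cinner w (x k)) \<longlonglongrightarrow> 0" by (simp add: cinner_commute[of w])
qed

text \<open>Gram--Schmidt: a finite orthonormal family in \<open>L\<close> does not span \<open>L\<close>, so it can be
  extended.\<close>

lemma infinite_dim_orthonormal_seq:
  fixes L :: "'a::complex_inner set"
  assumes sub: "csubspace L" and inf: "\<not> cfinite_dim L"
  obtains x where "orthonormal_seq x" "\<And>n. x n \<in> L"
proof (rule orthonormal_choice[where A = L and Q = "\<lambda>_ _ _. True"])
  fix f :: "nat \<Rightarrow> 'a" and n
  assume f: "orthonormal_below n f" and fL: "\<And>i. i < n \<Longrightarrow> f i \<in> L"
  have "cspan (f ` {..<n}) \<noteq> L" using inf by (auto simp: cfinite_dim_def)
  moreover have le: "cspan (f ` {..<n}) \<subseteq> L" by (rule complex_vector.span_minimal) (use fL sub in auto)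
  ultimately obtain v where v: "v \<in> L" "v \<notin> cspan (f ` {..<n})" by blast
  have p: "partial_proj n f v \<in> cspan (f ` {..<n})"
    unfolding partial_proj_def
    by (intro complex_vector.span_sum complex_vector.span_scale complex_vector.span_base) auto
  define u where "u = v - partial_proj n f v"
  have "u \<noteq> 0" using p v by (auto simp: u_def)
  moreover have "u \<in> L"
    using p v le sub by (auto simp: u_def intro: complex_vector.subspace_diff)
  moreover have "cinner u (f i) = 0" if "i < n" for i
    unfolding u_def using partial_proj_orthogonal[OF f that] .
  moreover have "sgn u \<in> L"
    unfolding sgn_div_norm scaleR_scaleC by (rule complex_vector.subspace_scale[OF sub \<open>u \<in> L\<close>])
  ultimately show "\<exists>v\<in>L. norm v = 1 \<and> (\<forall>i<n. cinner v (f i) = 0) \<and> True"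
    by (intro bexI[of _ "sgn u"]) (simp_all add: norm_sgn sgn_div_norm cinner.scaleR_left)
qed (auto intro: that)


section \<open>Compact operators\<close>

text \<open>A nuclear operator is a norm limit of its finite-rank truncations. Each truncation maps the
  unit ball into a compact set, so the image of the unit ball under the full sum is totally
  bounded.\<close>

lemma nuclear_operator_compact:
  fixes x w :: "nat \<Rightarrow> 'a::chilbert_space"
  assumes x: "\<And>r. norm (x r) \<le> 1" and w: "summable (\<lambda>r. norm (w r))"
  shows "compact_operator (\<lambda>v. \<Sum>r. cinner v (x r) *\<^sub>C w r)" (is "compact_operator ?K")
proof -
  have coeff: "cmod (cinner v (x r)) \<le> norm v" for v r
    using Cauchy_Schwarz[of v "x r"] mult_left_le[OF x[of r], of "norm v"] by simp
  have bound: "norm (cinner v (x r) *\<^sub>C w r) \<le> norm v * norm (w r)" for v r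
    unfolding norm_scaleC by (intro mult_right_mono coeff) simp
  have summ_norm: "summable (\<lambda>r. norm (cinner v (x r) *\<^sub>C w r))" for v
    by (rule summable_comparison_test'[where N = 0, OF summable_mult[OF w, of "norm v"]])
      (use bound in simp)
  hence summ: "summable (\<lambda>r. cinner v (x r) *\<^sub>C w r)" for v
    by (rule summable_norm_cancel)
  have add: "?K (u + v) = ?K u + ?K v" for u v
    using suminf_add[OF summ summ] by (simp add: cinner.add_left scaleC_add_left)
  have scale: "?K (c *\<^sub>C v) = c *\<^sub>C ?K v" for c v
    using bounded_linear.suminf[OF bounded_linear_scaleC_right summ]
    by (simp add: cinner_scaleC_left scaleC_scaleC)
  have norm_K: "norm (?K v) \<le> norm v * (\<Sum>r. norm (w r))" for v
  proof -
    have "norm (?K v) \<le> (\<Sum>r. norm (cinner v (x r) *\<^sub>C w r))" by (rule summable_norm[OF summ_norm])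
    also have "\<dots> \<le> (\<Sum>r. norm v * norm (w r))"
      by (rule suminf_le[OF bound summ_norm summable_mult[OF w]])
    also have "\<dots> = norm v * (\<Sum>r. norm (w r))" by (rule suminf_mult[OF w])
    finally show ?thesis .
  qed
  have bounded: "bounded_clinear ?K"
    unfolding bounded_clinear_def
    using scale by (auto intro!: bounded_linear_intro[OF add _ norm_K] simp: scaleR_scaleC)

  have truncation: "\<exists>C. compact C \<and> (\<forall>c. (\<forall>r. cmod (c r) \<le> 1) \<longrightarrow> (\<Sum>r<N. c r *\<^sub>C w r) \<in> C)" for N
  proof (induction N)
    case 0
    show ?case by (rule exI[of _ "{0}"]) simp
  next
    case (Suc N)
    then obtain C where C: "compact C"
      "\<And>c. (\<And>r. cmod (c r) \<le> 1) \<Longrightarrow> (\<Sum>r<N. c r *\<^sub>C w r) \<in> C" by blast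
    define D where "D = (\<lambda>c. c *\<^sub>C w N) ` cball 0 1"
    have "compact D" unfolding D_def
      by (intro compact_continuous_image bounded_linear.continuous_on[OF bounded_linear_scaleC_left]
          continuous_on_id) simp
    hence "compact {a + b |a b. a \<in> C \<and> b \<in> D}" by (rule compact_sums[OF C(1)])
    moreover have "(\<Sum>r<Suc N. c r *\<^sub>C w r) \<in> {a + b |a b. a \<in> C \<and> b \<in> D}"
      if "\<forall>r. cmod (c r) \<le> 1" for c
    proof -
      have "c N *\<^sub>C w N \<in> D" using that by (auto simp: D_def)
      moreover have "(\<Sum>r<N. c r *\<^sub>C w r) \<in> C" using that C(2) by blast
      ultimately show ?thesis by auto
    qed
    ultimately show ?case by blast
  qed
  \<comment> \<open>With doubled radius, an \<open>e / 4\<close>-net for a truncation covers the full sum once the tail is below \<open>e / 4\<close>.\<close>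
  have "compact (closure (?K ` cball 0 1))"
    unfolding compact_eq_totally_bounded
  proof (intro conjI allI impI)
    show "complete (closure (?K ` cball 0 1))" by (simp add: complete_eq_closed)
    fix e :: real assume e: "0 < e"
    obtain N where N: "\<forall>n\<ge>N. norm (\<Sum>i. norm (w (i + n))) < e / 4"
      using suminf_exist_split[OF _ w, of "e / 4"] e by auto
    obtain C where C: "compact C"
      "\<And>c. (\<And>r. cmod (c r) \<le> 1) \<Longrightarrow> (\<Sum>r<N. c r *\<^sub>C w r) \<in> C" using truncation[of N] by blast
    obtain k where k: "finite k" "C \<subseteq> (\<Union>y\<in>k. ball y (e / 4))"
      using C(1) e unfolding compact_eq_totally_bounded by (metis divide_pos_pos zero_less_numeral)
    have "?K v \<in> (\<Union>y\<in>k. cball y (e / 2))" if v: "v \<in> cball 0 1" for v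
    proof -
      define tail where "tail = (\<Sum>r. cinner v (x (r + N)) *\<^sub>C w (r + N))"
      have split: "?K v = tail + (\<Sum>r<N. cinner v (x r) *\<^sub>C w r)"
        unfolding tail_def by (rule suminf_split_initial_segment[OF summ])
      have c1: "cmod (cinner v (x r)) \<le> 1" for r using coeff[of v r] v by simp
      have wN: "summable (\<lambda>r. norm (w (r + N)))" using w summable_iff_shift[of "\<lambda>r. norm (w r)"] by simp
      have sN: "summable (\<lambda>r. norm (cinner v (x (r + N)) *\<^sub>C w (r + N)))"
        using summ_norm summable_iff_shift[of "\<lambda>r. norm (cinner v (x r) *\<^sub>C w r)"] by blast
      have "norm tail \<le> (\<Sum>r. norm (cinner v (x (r + N)) *\<^sub>C w (r + N)))"
        unfolding tail_def by (rule summable_norm[OF sN])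
      also have "\<dots> \<le> (\<Sum>r. norm (w (r + N)))"
        by (rule suminf_le[OF _ sN wN]) (simp add: norm_scaleC mult_left_le_one_le c1)
      also have "\<dots> < e / 4" using N by auto
      finally have tail: "norm tail < e / 4" .
      obtain y where y: "y \<in> k" "(\<Sum>r<N. cinner v (x r) *\<^sub>C w r) \<in> ball y (e / 4)"
        using C(2)[of "\<lambda>r. cinner v (x r)"] c1 k by blast
      have "norm (y - ?K v) \<le> norm (y - (\<Sum>r<N. cinner v (x r) *\<^sub>C w r)) + norm tail"
        unfolding split using norm_triangle_ineq4[of "y - (\<Sum>r<N. cinner v (x r) *\<^sub>C w r)" tail]
        by (simp add: algebra_simps)
      also have "\<dots> \<le> e / 2" using y(2) tail by (simp add: dist_norm)
      finally show ?thesis using y(1) by (auto simp: dist_norm)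
    qed
    hence "closure (?K ` cball 0 1) \<subseteq> (\<Union>y\<in>k. cball y (e / 2))"
      by (intro closure_minimal closed_UN k(1) ballI closed_cball) blast
    also have "\<dots> \<subseteq> (\<Union>y\<in>k. ball y e)" using e by (auto simp: dist_norm)
    finally show "\<exists>k. finite k \<and> closure (?K ` cball 0 1) \<subseteq> (\<Union>y\<in>k. ball y e)" using k(1) by blast
  qed
  with bounded show ?thesis by (simp add: compact_operator_def)
qed

text \<open>Matrices with respect to an orthonormal sequence may be prescribed freely, provided that the
  entries decay: the \<open>r\<close>-th column is then an absolutely convergent sum, and the columns are
  summable in norm.\<close>

lemma compact_operator_with_matrix:
  fixes x :: "nat \<Rightarrow> 'a::chilbert_space" and a :: "nat \<Rightarrow> nat \<Rightarrow> complex"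
  assumes x: "orthonormal_seq x" and a: "\<And>r s. cmod (a r s) \<le> (1/2) ^ (r + s)"
  obtains K where "compact_operator K" "\<And>r s. cinner (K (x r)) (x s) = a r s"
proof
  define w where "w r = (\<Sum>s. a r s *\<^sub>C x s)" for r
  define K where "K v = (\<Sum>r. cinner v (x r) *\<^sub>C w r)" for v
  have nx: "norm (x k) = 1" for k using orthonormal_seq_norm[OF x] .
  have geo: "summable (\<lambda>s. (1/2) ^ r * (1/2::real) ^ s)" for r
    by (intro summable_mult summable_geometric) simp
  have na: "norm (a r s *\<^sub>C x s) \<le> (1/2) ^ r * (1/2) ^ s" for r s
    using a[of r s] by (simp add: norm_scaleC nx power_add)
  have sn: "summable (\<lambda>s. norm (a r s *\<^sub>C x s))" for r
    by (rule summable_comparison_test'[where N = 0, OF geo]) (use na in simp)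
  have "norm (w r) \<le> (1/2) ^ r * 2" for r
  proof -
    have "norm (w r) \<le> (\<Sum>s. norm (a r s *\<^sub>C x s))" unfolding w_def by (rule summable_norm[OF sn])
    also have "\<dots> \<le> (\<Sum>s. (1/2) ^ r * (1/2) ^ s)" by (rule suminf_le[OF na sn geo])
    also have "\<dots> = (1/2) ^ r * 2" by (simp add: suminf_mult suminf_geometric)
    finally show ?thesis .
  qed
  hence "summable (\<lambda>r. norm (w r))"
    by (intro summable_comparison_test'[where N = 0, OF summable_mult2[OF summable_geometric]]) auto
  thus "compact_operator K"
    unfolding K_def by (intro nuclear_operator_compact) (simp_all add: nx)
  have single: "(\<Sum>q. if q = r then f q else 0) = f r" for r and f :: "nat \<Rightarrow> 'b::real_normed_vector"
    using sums_single[of r f] by (simp add: sums_iff)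
  show "cinner (K (x r)) (x s) = a r s" for r s
  proof -
    have "K (x r) = (\<Sum>q. if q = r then w q else 0)"
      unfolding K_def
      by (rule arg_cong[where f = suminf])
        (use x in \<open>auto simp: orthonormal_seq_def scaleC_one complex_vector.scale_zero_left\<close>)
    hence "K (x r) = w r" using single[of r w] by simp
    moreover have "cinner (w r) (x s) = (\<Sum>q. cinner (a r q *\<^sub>C x q) (x s))"
      unfolding w_def
      by (rule bounded_linear.suminf[OF cinner.bounded_linear_left summable_norm_cancel[OF sn]])
    moreover have "\<dots> = (\<Sum>q. if q = s then a r q else 0)"
      by (rule arg_cong[where f = suminf])
        (use x in \<open>auto simp: orthonormal_seq_def cinner_scaleC_left\<close>)
    ultimately show ?thesis using single[of s "a r"] by simp
  qed
qed

text \<open>A finite \<open>e\<close>-net of the image of the unit ball reduces the claim to finitely many fixed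
  vectors, against which the sequence is weakly null.\<close>

lemma compact_form_null:
  fixes K :: "'a::chilbert_space \<Rightarrow> 'a"
  assumes K: "compact_operator K" and x: "orthonormal_seq x"
  shows "(\<lambda>k. cinner (K (x k)) (x k)) \<longlonglongrightarrow> 0"
proof (rule LIMSEQ_I)
  fix e :: real assume e: "0 < e"
  have nx: "norm (x k) = 1" for k using orthonormal_seq_norm[OF x] .
  obtain N where N: "finite N" "closure (K ` cball 0 1) \<subseteq> (\<Union>y\<in>N. ball y (e / 2))"
    using K e unfolding compact_operator_def compact_eq_totally_bounded
    by (metis divide_pos_pos zero_less_numeral)
  have "\<forall>y\<in>N. eventually (\<lambda>k. cmod (cinner y (x k)) < e / 2) sequentially"
    using order_tendstoD(2)[OF tendsto_norm_zero[OF orthonormal_weakly_null'(2)[OF x]], of "e / 2"] e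
    by (intro ballI) simp
  hence "eventually (\<lambda>k. \<forall>y\<in>N. cmod (cinner y (x k)) < e / 2) sequentially"
    by (rule eventually_ball_finite[OF N(1)])
  hence "eventually (\<lambda>k. cmod (cinner (K (x k)) (x k)) < e) sequentially"
  proof eventually_elim
    case (elim k)
    have "K (x k) \<in> K ` cball 0 1" by (rule imageI) (simp add: nx)
    hence "K (x k) \<in> closure (K ` cball 0 1)" by (rule subsetD[OF closure_subset])
    then obtain y where y: "y \<in> N" "norm (y - K (x k)) < e / 2"
      using N(2) by (auto simp: dist_norm)
    have "cmod (cinner (K (x k)) (x k)) = cmod (cinner y (x k) - cinner (y - K (x k)) (x k))"
      by (simp add: cinner.diff_left)
    also have "\<dots> \<le> cmod (cinner y (x k)) + cmod (cinner (y - K (x k)) (x k))"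
      by (rule norm_triangle_ineq4)
    also have "\<dots> < e"
    proof -
      have "cmod (cinner (y - K (x k)) (x k)) \<le> norm (y - K (x k))"
        using Cauchy_Schwarz[of "y - K (x k)" "x k"] by (simp add: nx)
      moreover have "cmod (cinner y (x k)) < e / 2" using elim y(1) by blast
      ultimately show ?thesis using y(2) by linarith
    qed
    finally show ?case .
  qed
  thus "\<exists>n. \<forall>k\<ge>n. norm (cinner (K (x k)) (x k) - 0) < e"
    by (simp add: eventually_sequentially)
qed


section \<open>The essential numerical range\<close>

text \<open>By weak convergence the projections of \<open>y k\<close> onto the span of the \<open>f i\<close> tend to zero, so
  subtracting them and normalizing changes \<open>y k\<close> by an amount that tends to zero.\<close>

lemma perturb_into_orthogonal_complement:
  fixes y :: "nat \<Rightarrow> 'a::complex_inner"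
  assumes y: "orthonormal_seq y" and f: "orthonormal_below n f"
  obtains z where "(\<lambda>k. z k - y k) \<longlonglongrightarrow> 0"
    "\<And>k. norm (z k) \<le> 1"
    "eventually (\<lambda>k. norm (z k) = 1 \<and> (\<forall>i<n. cinner (z k) (f i) = 0)) sequentially"
proof
  define u where "u k = y k - partial_proj n f (y k)" for k
  have ny: "norm (y k) = 1" for k using orthonormal_seq_norm[OF y] .
  have "(\<lambda>k. \<Sum>r<n. cinner (y k) (f r) *\<^sub>C f r) \<longlonglongrightarrow> (\<Sum>r<n. 0 *\<^sub>C f r)"
    by (intro tendsto_sum bounded_linear.tendsto[OF bounded_linear_scaleC_left]
        orthonormal_weakly_null'(1)[OF y])
  hence p: "(\<lambda>k. partial_proj n f (y k)) \<longlonglongrightarrow> 0"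
    by (simp add: partial_proj_def complex_vector.scale_zero_left)
  have bound: "norm (sgn (u k) - y k) \<le> 2 * norm (partial_proj n f (y k))" for k
  proof -
    have "norm (sgn (u k) - u k) \<le> norm (partial_proj n f (y k))"
    proof (cases "u k = 0")
      case False
      have "sgn (u k) - u k = (1 / norm (u k) - 1) *\<^sub>R u k"
        by (simp add: sgn_div_norm scaleR_diff_left divide_inverse)
      hence "norm (sgn (u k) - u k) = \<bar>1 / norm (u k) - 1\<bar> * norm (u k)" by simp
      also have "\<dots> = \<bar>(1 / norm (u k) - 1) * norm (u k)\<bar>" by (simp add: abs_mult)
      also have "(1 / norm (u k) - 1) * norm (u k) = norm (y k) - norm (u k)"
        using False by (simp add: ny left_diff_distrib)
      also have "\<bar>norm (y k) - norm (u k)\<bar> \<le> norm (y k - u k)" by (rule norm_triangle_ineq3)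
      finally show ?thesis by (simp add: u_def)
    qed simp
    moreover have "norm (u k - y k) = norm (partial_proj n f (y k))" by (simp add: u_def)
    ultimately show ?thesis using norm_triangle_ineq[of "sgn (u k) - u k" "u k - y k"] by simp
  qed
  show "(\<lambda>k. sgn (u k) - y k) \<longlonglongrightarrow> 0"
  proof (rule Lim_null_comparison)
    show "\<forall>\<^sub>F k in sequentially. norm (sgn (u k) - y k) \<le> 2 * norm (partial_proj n f (y k))"
      using bound by simp
    show "(\<lambda>k. 2 * norm (partial_proj n f (y k))) \<longlonglongrightarrow> 0"
      by (rule tendsto_mult_right_zero[OF tendsto_norm_zero[OF p]])
  qed
  show "norm (sgn (u k)) \<le> 1" for k by (simp add: norm_sgn)
  have "\<forall>\<^sub>F k in sequentially. norm (partial_proj n f (y k)) < 1"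
    using order_tendstoD(2)[OF tendsto_norm_zero[OF p]] by simp
  thus "\<forall>\<^sub>F k in sequentially. norm (sgn (u k)) = 1 \<and> (\<forall>i<n. cinner (sgn (u k)) (f i) = 0)"
  proof eventually_elim
    case (elim k)
    have "u k \<noteq> 0" using elim ny[of k] by (auto simp: u_def)
    moreover have "cinner (u k) (f i) = 0" if "i < n" for i
      unfolding u_def using partial_proj_orthogonal[OF f that] .
    ultimately show ?case by (simp add: norm_sgn sgn_div_norm cinner.scaleR_left)
  qed
qed

text \<open>The approximating unit vectors can be moved into the orthogonal complement of finitely many
  vectors, and there they become almost orthogonal to the images of these vectors as well. This is
  the induction step for choosing vectors with respect to which all \<open>T j\<close> are nearly diagonal.\<close>

lemma W_ess_unit_vector:
  fixes T :: "'n::finite \<Rightarrow> 'a::chilbert_space \<Rightarrow> 'a"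
  assumes T: "\<And>j. bounded_clinear (T j)" and l: "l \<in> W_ess T"
    and f: "orthonormal_below n f" and e: "0 < e"
  shows "\<exists>v. norm v = 1 \<and> (\<forall>i<n. cinner v (f i) = 0) \<and>
    (\<forall>j. cmod (cinner (T j v) v - l $ j) < e \<and>
      (\<forall>i<n. cmod (cinner (T j v) (f i)) < e \<and> cmod (cinner (T j (f i)) v) < e))"
proof -
  obtain y where y: "orthonormal_seq y" and yl: "\<And>j. (\<lambda>k. cinner (T j (y k)) (y k)) \<longlonglongrightarrow> l $ j"
    using l by (auto simp: W_ess_def)
  obtain z where zy: "(\<lambda>k. z k - y k) \<longlonglongrightarrow> 0" and nz: "\<And>k. norm (z k) \<le> 1"
    and z: "\<forall>\<^sub>F k in sequentially. norm (z k) = 1 \<and> (\<forall>i<n. cinner (z k) (f i) = 0)"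
    using perturb_into_orthogonal_complement[OF y f] by blast
  have ny: "norm (y k) = 1" for k using orthonormal_seq_norm[OF y] .
  have lin: "bounded_linear (T j)" for j using T by (simp add: bounded_clinear_def)
  have "\<forall>\<^sub>F k in sequentially. cmod (cinner (T j (z k)) (z k) - l $ j) < e \<and>
      (\<forall>i\<in>{..<n}. cmod (cinner (T j (z k)) (f i)) < e \<and> cmod (cinner (T j (f i)) (z k)) < e)" for j
  proof -
    obtain B where B: "\<And>v. norm (T j v) \<le> norm v * B" and B0: "0 < B"
      using bounded_linear.pos_bounded[OF lin] by blast
    have diff: "cmod (cinner (T j (z k)) (z k) - cinner (T j (y k)) (y k)) \<le> norm (z k - y k) * (2 * B)" for k
    proof -
      have "cinner (T j (z k)) (z k) - cinner (T j (y k)) (y k)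
          = cinner (T j (z k - y k)) (z k) + cinner (T j (y k)) (z k - y k)"
        by (simp add: linear_diff[OF bounded_linear.linear[OF lin]] cinner.diff_left cinner.diff_right)
      also have "cmod \<dots> \<le> norm (T j (z k - y k)) * norm (z k) + norm (T j (y k)) * norm (z k - y k)"
        by (intro norm_triangle_le add_mono Cauchy_Schwarz)
      also have "\<dots> \<le> (norm (z k - y k) * B) * 1 + (norm (y k) * B) * norm (z k - y k)"
        using B0 by (intro add_mono mult_mono B nz) (auto simp: ny)
      finally show ?thesis by (simp add: ny algebra_simps)
    qed
    have d: "(\<lambda>k. cinner (T j (z k)) (z k) - cinner (T j (y k)) (y k)) \<longlonglongrightarrow> 0"
    proof (rule Lim_null_comparison)
      show "(\<lambda>k. norm (z k - y k) * (2 * B)) \<longlonglongrightarrow> 0"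
        by (rule tendsto_mult_left_zero[OF tendsto_norm_zero[OF zy]])
    qed (use diff in simp)
    have "(\<lambda>k. cinner (T j (z k)) (z k)) \<longlonglongrightarrow> l $ j"
      using tendsto_add[OF d yl[of j]] by simp
    from tendsto_norm_zero[OF LIM_zero[OF this]]
    have 1: "\<forall>\<^sub>F k in sequentially. cmod (cinner (T j (z k)) (z k) - l $ j) < e"
      using e by (rule order_tendstoD(2))
    have 2: "\<forall>\<^sub>F k in sequentially. cmod (cinner (T j (z k)) (f i)) < e" for i
    proof -
      have "(\<lambda>k. cinner (T j (z k - y k)) (f i)) \<longlonglongrightarrow> cinner (T j 0) (f i)"
        by (intro cinner.tendsto bounded_linear.tendsto[OF lin] zy tendsto_const)
      from tendsto_add[OF this orthonormal_weakly_null[OF y T, of j "f i"]]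
      have "(\<lambda>k. cinner (T j (z k)) (f i)) \<longlonglongrightarrow> 0"
        by (simp add: linear_diff[OF bounded_linear.linear[OF lin]] cinner.diff_left
            linear_0[OF bounded_linear.linear[OF lin]] cinner.zero_left)
      from tendsto_norm_zero[OF this] e show ?thesis by (rule order_tendstoD(2))
    qed
    have 3: "\<forall>\<^sub>F k in sequentially. cmod (cinner (T j (f i)) (z k)) < e" for i
    proof -
      have "(\<lambda>k. cinner (T j (f i)) (z k - y k)) \<longlonglongrightarrow> cinner (T j (f i)) 0"
        by (intro cinner.tendsto zy tendsto_const)
      from tendsto_add[OF this orthonormal_weakly_null'(2)[OF y, of "T j (f i)"]]
      have "(\<lambda>k. cinner (T j (f i)) (z k)) \<longlonglongrightarrow> 0"
        by (simp add: cinner.diff_right cinner.zero_right)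
      from tendsto_norm_zero[OF this] e show ?thesis by (rule order_tendstoD(2))
    qed
    show ?thesis
      using 1 2 3 by (intro eventually_conj eventually_ball_finite ballI) auto
  qed
  hence "\<forall>\<^sub>F k in sequentially. \<forall>j. cmod (cinner (T j (z k)) (z k) - l $ j) < e \<and>
      (\<forall>i\<in>{..<n}. cmod (cinner (T j (z k)) (f i)) < e \<and> cmod (cinner (T j (f i)) (z k)) < e)"
    by (rule eventually_all_finite)
  from eventually_conj[OF z this] show ?thesis
    by (auto dest!: eventually_happens' [OF sequentially_bot])
qed

text \<open>One orthonormal sequence serves countably many points of the essential numerical range at
  once: up to rapidly decaying errors, all \<open>T j\<close> are diagonal along it, with the prescribed points
  on the diagonal.\<close>

lemma nearly_diagonalizing_sequence:
  fixes T :: "'n::finite \<Rightarrow> 'a::chilbert_space \<Rightarrow> 'a"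
  assumes T: "\<And>j. bounded_clinear (T j)" and \<mu>: "\<And>s::nat. \<mu> s \<in> W_ess T"
  obtains x where "orthonormal_seq x"
    "\<And>j r s. cmod (cinner (T j (x r)) (x s) - (if r = s then \<mu> s $ j else 0)) \<le> (1/2) ^ (r + s)"
proof -
  define Q where "Q f n v \<longleftrightarrow> (\<forall>j. cmod (cinner (T j v) v - \<mu> n $ j) < (1/4) ^ n \<and>
      (\<forall>i<n. cmod (cinner (T j v) (f i)) < (1/4) ^ n \<and> cmod (cinner (T j (f i)) v) < (1/4) ^ n))"
    for f n v
  obtain x where x: "orthonormal_seq x" and Q: "\<And>n. Q x n (x n)"
  proof (rule orthonormal_choice[where A = UNIV and Q = Q])
    show "Q f n v = Q g n v" if "\<And>i. i < n \<Longrightarrow> f i = g i" for f g n v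
      using that by (simp add: Q_def)
    show "\<exists>v\<in>UNIV. norm v = 1 \<and> (\<forall>i<n. cinner v (f i) = 0) \<and> Q f n v"
      if "orthonormal_below n f" for f n
      using W_ess_unit_vector[OF T \<mu>[of n] that, of "(1/4) ^ n"] by (simp add: Q_def)
  qed blast
  \<comment> \<open>The bound at stage \<open>n\<close> has to cover all entries \<open>(m, n)\<close> and \<open>(n, m)\<close> with \<open>m \<le> n\<close>.\<close>
  have four: "(1/4::real) ^ n = (1/2) ^ (n + n)" for n
    by (simp add: power_add flip: power_mult_distrib)
  have decay: "(1/4::real) ^ n \<le> (1/2) ^ (n + m)" if "m \<le> n" for m n
    unfolding four by (rule power_decreasing) (use that in auto)
  show thesis
  proof (rule that[OF x])
    fix j r s
    show "cmod (cinner (T j (x r)) (x s) - (if r = s then \<mu> s $ j else 0)) \<le> (1/2) ^ (r + s)"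
    proof (cases r s rule: linorder_cases)
      case less
      have "cmod (cinner (T j (x r)) (x s)) < (1/4) ^ s" using Q[of s] less unfolding Q_def by blast
      also have "\<dots> \<le> (1/2) ^ (r + s)" using decay[of r s] less by (simp add: add.commute)
      finally show ?thesis using less by simp
    next
      case equal
      have "cmod (cinner (T j (x s)) (x s) - \<mu> s $ j) < (1/4) ^ s" using Q[of s] unfolding Q_def by blast
      also have "\<dots> \<le> (1/2) ^ (s + s)" by (rule decay) simp
      finally show ?thesis using equal by simp
    next
      case greater
      have "cmod (cinner (T j (x r)) (x s)) < (1/4) ^ r" using Q[of r] greater unfolding Q_def by blast
      also have "\<dots> \<le> (1/2) ^ (r + s)" using greater by (intro decay) simp
      finally show ?thesis using greater by simp
    qed
  qed
qed

text \<open>If the prescribed diagonal converges to \<open>l\<close>, then so do the forms of the \<open>T j\<close> along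
  the constructed sequence, which therefore witnesses \<open>l \<in> W_ess T\<close>.\<close>

lemma closed_W_ess:
  fixes T :: "'n::finite \<Rightarrow> 'a::chilbert_space \<Rightarrow> 'a"
  assumes T: "\<And>j. bounded_clinear (T j)"
  shows "closed (W_ess T)"
  unfolding closed_sequential_limits
proof (intro allI impI, elim conjE)
  fix \<mu> l assume \<mu>: "\<forall>s. \<mu> s \<in> W_ess T" and lim: "\<mu> \<longlonglongrightarrow> l"
  obtain x where x: "orthonormal_seq x" and
    d: "\<And>j r s. cmod (cinner (T j (x r)) (x s) - (if r = s then \<mu> s $ j else 0)) \<le> (1/2) ^ (r + s)"
    using nearly_diagonalizing_sequence[where T = T and \<mu> = \<mu>, OF T] \<mu> by blast
  have "(\<lambda>s. cinner (T j (x s)) (x s)) \<longlonglongrightarrow> l $ j" for j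
  proof -
    have "(\<lambda>s. cinner (T j (x s)) (x s) - \<mu> s $ j) \<longlonglongrightarrow> 0"
    proof (rule Lim_null_comparison)
      have "(1/2::real) ^ (s + s) \<le> (1/2) ^ s" for s by (rule power_decreasing) auto
      from order_trans[OF d[of j _ _] this]
      have "cmod (cinner (T j (x s)) (x s) - \<mu> s $ j) \<le> (1/2) ^ s" for s by fastforce
      thus "\<forall>\<^sub>F s in sequentially. norm (cinner (T j (x s)) (x s) - \<mu> s $ j) \<le> (1/2) ^ s" by simp
      show "(\<lambda>s. (1/2::real) ^ s) \<longlonglongrightarrow> 0" by (rule LIMSEQ_power_zero) simp
    qed
    from tendsto_add[OF this tendsto_vec_nth[OF lim, of j]] show ?thesis by simp
  qed
  with x show "l \<in> W_ess T" by (auto simp: W_ess_def)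
qed


section \<open>The infinite numerical range\<close>

lemma W_infty_iff:
  fixes S :: "'n::finite \<Rightarrow> 'a::chilbert_space \<Rightarrow> 'a"
  shows "l \<in> W_infty S \<longleftrightarrow> (\<exists>L. csubspace L \<and> closed L \<and> \<not> cfinite_dim L \<and>
    (\<forall>j. \<forall>y\<in>L. \<forall>z\<in>L. cinner (S j y - l $ j *\<^sub>C y) z = 0))"
  unfolding W_infty_def mem_Collect_eq
  by (intro ex_cong1 conj_cong refl all_cong1 compression_scalar_iff)

lemma W_infty_compact_perturbation_subset:
  fixes T :: "'n::finite \<Rightarrow> 'a::chilbert_space \<Rightarrow> 'a"
  assumes K: "\<And>j. compact_operator (K j)"
  shows "W_infty (\<lambda>j x. T j x - K j x) \<subseteq> W_ess T"
proof
  fix l assume "l \<in> W_infty (\<lambda>j x. T j x - K j x)"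
  then obtain L where L: "csubspace L" "closed L" "\<not> cfinite_dim L"
    and form: "\<And>j y z. y \<in> L \<Longrightarrow> z \<in> L \<Longrightarrow> cinner (T j y - K j y - l $ j *\<^sub>C y) z = 0"
    unfolding W_infty_iff by blast
  obtain x where x: "orthonormal_seq x" and xL: "\<And>n. x n \<in> L"
    using infinite_dim_orthonormal_seq[OF L(1,3)] by blast
  have "cinner (T j (x k)) (x k) = l $ j + cinner (K j (x k)) (x k)" for j k
  proof -
    have "cinner (T j (x k)) (x k) - cinner (K j (x k)) (x k) - l $ j = 0"
      using form[OF xL xL, of j k k] x
      by (simp add: cinner.diff_left cinner_scaleC_left orthonormal_seq_def)
    thus ?thesis by (simp add: algebra_simps)
  qed
  hence "(\<lambda>k. cinner (T j (x k)) (x k)) \<longlonglongrightarrow> l $ j" for j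
    using tendsto_add[OF tendsto_const compact_form_null[OF K[of j] x], of "l $ j"] by simp
  with x show "l \<in> W_ess T" by (auto simp: W_ess_def)
qed

lemma not_cfinite_dim_if_orthonormal:
  assumes x: "orthonormal_seq x" and I: "infinite I" and L: "x ` I \<subseteq> L"
  shows "\<not> cfinite_dim L"
proof
  assume "cfinite_dim L"
  then obtain B where B: "finite B" "cspan B = L" by (auto simp: cfinite_dim_def)
  have "inj x"
  proof (rule injI)
    fix r s assume "x r = x s"
    hence "cinner (x r) (x s) = 1" using x by (metis orthonormal_seq_def)
    thus "r = s" using x by (auto simp: orthonormal_seq_def split: if_splits)
  qed
  have "complex_vector.independent (x ` I)"
    unfolding complex_vector.dependent_def
  proof
    assume "\<exists>a\<in>x ` I. a \<in> cspan (x ` I - {a})"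
    then obtain r where r: "x r \<in> cspan (x ` I - {x r})" by blast
    have "cspan (x ` I - {x r}) \<subseteq> {v. cinner v (x r) = 0}"
    proof (rule complex_vector.span_minimal)
      show "x ` I - {x r} \<subseteq> {v. cinner v (x r) = 0}" using x by (auto simp: orthonormal_seq_def)
      show "csubspace {v. cinner v (x r) = 0}"
        by (rule complex_vector.subspaceI)
          (simp_all add: cinner.zero_left cinner.add_left cinner_scaleC_left)
    qed
    with r x show False by (auto simp: orthonormal_seq_def)
  qed
  hence "finite (x ` I)"
    using complex_vector.independent_span_bound[OF B(1)] B(2) L by blast
  thus False using I \<open>inj x\<close> by (meson finite_imageD inj_on_subset subset_UNIV)
qed

text \<open>The subspace is the closed span of the vectors, taken as the least closed subspace that
  contains them. An identity that is continuous and sesquilinear passes from the vectors to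
  it, one variable at a time.\<close>

lemma W_infty_if_scalar_along_sequence:
  fixes S :: "'n::finite \<Rightarrow> 'a::chilbert_space \<Rightarrow> 'a"
  assumes S: "\<And>j. bounded_clinear (S j)" and x: "orthonormal_seq x" and I: "infinite I"
    and scalar: "\<And>j r s. r \<in> I \<Longrightarrow> s \<in> I \<Longrightarrow> cinner (S j (x r)) (x s) = (if r = s then l $ j else 0)"
  shows "l \<in> W_infty S"
proof -
  define L where "L = \<Inter>{M. csubspace M \<and> closed M \<and> x ` I \<subseteq> M}"
  have L: "csubspace L" "closed L" "x ` I \<subseteq> L"
    unfolding L_def by (auto intro: complex_vector.subspace_Inter)
  have least: "L \<subseteq> M" if "csubspace M" "closed M" "x ` I \<subseteq> M" for M
    using that by (auto simp: L_def)
  have form: "cinner (S j y - l $ j *\<^sub>C y) z = 0" if y: "y \<in> L" and z: "z \<in> L" for j y z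
  proof -
    have lin: "bounded_linear (S j)" and sc: "\<And>c v. S j (c *\<^sub>C v) = c *\<^sub>C S j v"
      using S by (auto simp: bounded_clinear_def)
    have left: "cinner (S j y - l $ j *\<^sub>C y) (x s) = 0" if s: "s \<in> I" for s
    proof -
      define M where "M = {y. cinner (S j y - l $ j *\<^sub>C y) (x s) = 0}"
      have "csubspace M"
        unfolding M_def
        by (rule complex_vector.subspaceI)
          (simp_all add: linear_0[OF bounded_linear.linear[OF lin]] linear_add[OF bounded_linear.linear[OF lin]] sc
            cinner.diff_left cinner.add_left cinner.zero_left cinner_scaleC_left algebra_simps)
      moreover have "closed M"
        unfolding M_def
        by (intro closed_Collect_eq cinner.continuous_on continuous_intros
            bounded_linear.continuous_on[OF lin] bounded_linear.continuous_on[OF bounded_linear_scaleC_right])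
      moreover have "x ` I \<subseteq> M"
        using s x scalar by (auto simp: M_def cinner.diff_left cinner_scaleC_left orthonormal_seq_def)
      ultimately show ?thesis using least y by (auto simp: M_def)
    qed
    define M where "M = {z. cinner (S j y - l $ j *\<^sub>C y) z = 0}"
    have "csubspace M"
      unfolding M_def
      by (rule complex_vector.subspaceI)
        (simp_all add: cinner.add_right cinner.zero_right cinner_scaleC_right)
    moreover have "closed M"
      unfolding M_def by (intro closed_Collect_eq cinner.continuous_on continuous_intros)
    moreover have "x ` I \<subseteq> M" using left by (auto simp: M_def)
    ultimately show ?thesis using least z by (auto simp: M_def)
  qed
  have "\<not> cfinite_dim L" by (rule not_cfinite_dim_if_orthonormal[OF x I L(3)])
  with L form show ?thesis unfolding W_infty_iff by blast
qed

text \<open>A single compact \<open>K j\<close> cancels the whole error matrix of \<open>T j\<close>, so that \<open>T j - K j\<close>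
  is exactly diagonal along the sequence. The indices \<open>s\<close> with \<open>\<mu> s = l\<close> then select the vectors that
  span a subspace for \<open>l\<close>.\<close>

lemma compact_perturbation_attains:
  fixes T :: "'n::finite \<Rightarrow> 'a::chilbert_space \<Rightarrow> 'a"
  assumes T: "\<And>j. bounded_clinear (T j)" and \<mu>: "\<And>s::nat. \<mu> s \<in> W_ess T"
  obtains K where "\<And>j. compact_operator (K j)"
    "\<And>l. infinite {s. \<mu> s = l} \<Longrightarrow> l \<in> W_infty (\<lambda>j x. T j x - K j x)"
proof -
  obtain x where x: "orthonormal_seq x" and
    d: "\<And>j r s. cmod (cinner (T j (x r)) (x s) - (if r = s then \<mu> s $ j else 0)) \<le> (1/2) ^ (r + s)"
    using nearly_diagonalizing_sequence[where T = T and \<mu> = \<mu>, OF T \<mu>] by blast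
  have "\<exists>K. compact_operator K \<and> (\<forall>r s. cinner (K (x r)) (x s) =
      cinner (T j (x r)) (x s) - (if r = s then \<mu> s $ j else 0))" for j
    using compact_operator_with_matrix[OF x d[of j]] by metis
  then obtain K where K: "\<And>j. compact_operator (K j)" and
    Kx: "\<And>j r s. cinner (K j (x r)) (x s) = cinner (T j (x r)) (x s) - (if r = s then \<mu> s $ j else 0)"
    by metis
  have TK: "bounded_clinear (\<lambda>v. T j v - K j v)" for j
    using T[of j] K[of j]
    by (simp add: bounded_clinear_def compact_operator_def bounded_linear_sub
        complex_vector.scale_right_diff_distrib)
  show thesis
  proof (rule that[OF K])
    fix l assume "infinite {s. \<mu> s = l}"
    thus "l \<in> W_infty (\<lambda>j x. T j x - K j x)"
      by (rule W_infty_if_scalar_along_sequence[OF TK x]) (simp add: cinner.diff_left Kx)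
  qed
qed


section \<open>Essential and infinite numerical ranges\<close>

theorem theorem5p10:
  fixes T :: "'n::finite \<Rightarrow> 'a::chilbert_space \<Rightarrow> 'a"
  assumes "\<not> cfinite_dim (UNIV :: 'a set)"
    and "separable_space (euclidean :: 'a topology)"
    and "\<And>j. bounded_clinear (T j)"
  shows "W_ess T = (\<Union>K\<in>{K. \<forall>j. compact_operator (K j)}. W_infty (\<lambda>j x. T j x - K j x))
    \<and> (\<exists>K. (\<forall>j. compact_operator (K j)) \<and>
          W_ess T = closure (W_infty (\<lambda>j x. T j x - K j x)))"
proof (intro conjI equalityI subsetI)
  note T = assms(3)
  fix l
  assume "l \<in> W_ess T"
  then obtain K where K: "\<And>j. compact_operator (K j)"
    and att: "\<And>m. infinite {s::nat. l = m} \<Longrightarrow> m \<in> W_infty (\<lambda>j x. T j x - K j x)"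
    using compact_perturbation_attains[where T = T and \<mu> = "\<lambda>_. l", OF T] by blast
  have "l \<in> W_infty (\<lambda>j x. T j x - K j x)" by (rule att) simp
  with K show "l \<in> (\<Union>K\<in>{K. \<forall>j. compact_operator (K j)}. W_infty (\<lambda>j x. T j x - K j x))" by blast
next
  fix l assume "l \<in> (\<Union>K\<in>{K. \<forall>j. compact_operator (K j)}. W_infty (\<lambda>j x. T j x - K j x))"
  thus "l \<in> W_ess T" using W_infty_compact_perturbation_subset by blast
next
  note T = assms(3)
  obtain D where D: "countable D" "D \<subseteq> W_ess T" "W_ess T \<subseteq> closure D"
    using separable by blast
  show "\<exists>K. (\<forall>j. compact_operator (K j)) \<and> W_ess T = closure (W_infty (\<lambda>j x. T j x - K j x))"
  \<comment> \<open>Enumerating \<open>D\<close> by \<open>from_nat_into\<close> presupposes that \<open>D\<close> has an element.\<close>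
  proof (cases "W_ess T = {}")
    case True
    have zero: "compact_operator (\<lambda>_::'a. 0)"
      by (simp add: compact_operator_def bounded_clinear_def bounded_linear_zero image_constant_conv)
    have "W_infty (\<lambda>j x. T j x - 0) \<subseteq> W_ess T"
      by (rule W_infty_compact_perturbation_subset[where K = "\<lambda>_ _. 0", OF zero])
    with True zero show ?thesis by (intro exI[of _ "\<lambda>_ _. 0"]) auto
  next
    case False
    hence D0: "D \<noteq> {}" using D(3) by auto
    \<comment> \<open>Pairing makes the enumeration visit every point of \<open>D\<close> infinitely often.\<close>
    define \<mu> where "\<mu> s = from_nat_into D (fst (prod_decode s))" for s
    have \<mu>: "\<mu> s \<in> W_ess T" for s using from_nat_into[OF D0] D(2) by (auto simp: \<mu>_def)
    obtain K where K: "\<And>j. compact_operator (K j)"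
      and att: "\<And>l. infinite {s. \<mu> s = l} \<Longrightarrow> l \<in> W_infty (\<lambda>j x. T j x - K j x)"
      using compact_perturbation_attains[where T = T and \<mu> = \<mu>, OF T \<mu>] by blast
    have inf: "infinite {s. \<mu> s = d}" if d: "d \<in> D" for d
    proof -
      obtain i where i: "from_nat_into D i = d" using from_nat_into_surj[OF D(1) d] by blast
      have "range (\<lambda>m. prod_encode (i, m)) \<subseteq> {s. \<mu> s = d}" by (auto simp: \<mu>_def i)
      moreover have "infinite (range (\<lambda>m. prod_encode (i, m)))"
        by (rule range_inj_infinite) (auto intro: injI)
      ultimately show ?thesis using finite_subset by blast
    qed
    have "W_ess T = closure (W_infty (\<lambda>j x. T j x - K j x))"
    proof
      have "D \<subseteq> W_infty (\<lambda>j x. T j x - K j x)" using att inf by blast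
      thus "W_ess T \<subseteq> closure (W_infty (\<lambda>j x. T j x - K j x))"
        using D(3) closure_mono by blast
      show "closure (W_infty (\<lambda>j x. T j x - K j x)) \<subseteq> W_ess T"
        by (rule closure_minimal[OF W_infty_compact_perturbation_subset[OF K] closed_W_ess[OF T]])
    qed
    with K show ?thesis by blast
  qed
qed

end
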